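(* Let $H\colon T^{*}\mathbb{R}^{d}\cong\mathbb{R}^{2d}\to\mathbb{R}$ be a smooth Hamiltonian and let $\hat H\colon T^{*}\mathbb{R}^{2d}\cong\mathbb{R}^{4d}\to\mathbb{R}$, $\hat H(q,x,p,y)=H(q,y)+H(x,p)$, be its associated extended Hamiltonian. Let $\mathsf{G}$ be a matrix Lie subgroup of $\mathrm{Sp}(2d,\mathbb{R})$, let $\mathfrak{g}\subset\mathfrak{sp}(2d,\mathbb{R})$ be its Lie algebra, and let $\mathfrak{g}_{\mathrm{sym}}=\mathbb{J}^{T}\mathfrak{g}=\{\mathbb{J}^{T}\varkappa:\varkappa\in\mathfrak{g}\}\subset\mathrm{sym}(2d,\mathbb{R})$. For $\kappa=\begin{bmatrix}\kappa_{11}&\kappa_{12}\\ \kappa_{12}^{T}&\kappa_{22}\end{bmatrix}\in\mathrm{sym}(2d,\mathbb{R})$ (with $d\times d$ blocks), define $$Q_{\kappa}(z)=\tfrac12 z^{T}\kappa z=\tfrac12 q^{T}\kappa_{11}q+q^{T}\kappa_{12}p+\tfrac12 p^{T}\kappa_{22}p,\qquad z=(q,p),$$ $$\hat Q_{\kappa}(\zeta)=\tfrac12\left(q^{T}\kappa_{11}x+q^{T}\kappa_{12}p+x^{T}\kappa_{12}y+y^{T}\kappa_{22}p\right),\qquad \zeta=(q,x,p,y).$$ (i) If $H$ has $\mathsf{G}$-symmetry, i.e. $H(Sz)=H(z)$ for all $S\in\mathsf{G}$ and all $z\in\mathbb{R}^{2d}$, then $\hat H(\hat\Psi_{S}(\zeta))=\hat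 H(\zeta)$ for all $S\in\mathsf{G}$ and all $\zeta\in\mathbb{R}^{4d}$, where $\hat\Psi$ is the action of $\mathsf{G}$ on $\mathbb{R}^{4d}$ defined in the context. As a result, for any $\kappa\in\mathfrak{g}_{\mathrm{sym}}$, $Q_{\kappa}$ is an invariant of the original Hamiltonian system $$\dot q=D_{2}H(q,p),\quad \dot p=-D_{1}H(q,p),$$ and $\hat Q_{\kappa}$ is an invariant of the extended Hamiltonian system $$\dot q=D_{2}H(x,p),\quad \dot p=-D_{1}H(q,y),\quad \dot x=D_{2}H(q,y),\quad \dot y=-D_{1}H(x,p).$$ (ii) For any $\kappa\in\mathrm{sym}(2d,\mathbb{R})$, $Q_{\kappa}$ is a quadratic invariant of the original Hamiltonian system if and only if $\hat Q_{\kappa}$ is a quadratic invariant of the extended Hamiltonian system.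
   Context: $D_{1}H,D_{2}H$ denote the partial gradients of $H$ with respect to its first and second $\mathbb{R}^{d}$-valued arguments; tuples denote column vectors. $\mathbb{J}=\begin{bmatrix}0&I_{d}\\-I_{d}&0\end{bmatrix}$; $\mathrm{Sp}(2d,\mathbb{R})=\{S\in\mathbb{R}^{2d\times2d}:S^{T}\mathbb{J}S=\mathbb{J}\}$; $\mathfrak{sp}(2d,\mathbb{R})=\{\varkappa\in\mathbb{R}^{2d\times2d}:\varkappa^{T}\mathbb{J}+\mathbb{J}\varkappa=0\}$; $\mathrm{sym}(2d,\mathbb{R})$ is the space of real symmetric $2d\times2d$ matrices. The group $\mathsf{G}$ acts on $\mathbb{R}^{2d}$ by matrix-vector multiplication, and on the extended phase space $\mathbb{R}^{4d}$ by $$\hat\Psi_{S}(q,x,p,y)=\left(\mathsf{A}q+\mathsf{B}y,\ \mathsf{A}x+\mathsf{B}p,\ \mathsf{C}x+\mathsf{D}p,\ \mathsf{C}q+\mathsf{D}y\right)\quad\text{for } S=\begin{bmatrix}\mathsf{A}&\mathsf{B}\\ \mathsf{C}&\mathsf{D}\end{bmatrix}\in\mathsf{G}$$ with $d\times d$ blocks. The extended system is the canonical Hamiltonian system on $\mathbb{R}^{4d}$ (positions $(q,x)$, momenta $(p,y)$) with Hamiltonian $\hat H$. A function is an invariant of an ODE system if it is constant along all solutions; for a smooth function and a Hamiltonian system this is equivalent to the identical vanishing of its Poisson bracket with the Hamiltonian. *)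

theory Defs
  imports "HOL-Analysis.Analysis"
begin

text \<open>
  The index type of \<open>\<real>\<^sup>2\<^sup>d\<close> is \<^typ>\<open>'d + 'd\<close>: \<^const>\<open>Inl\<close> indexes the positions,
  \<^const>\<open>Inr\<close> the momenta.  The extended phase space \<open>\<real>\<^sup>4\<^sup>d\<close> consists of the quadruples
  \<open>(q, x, p, y)\<close>.
\<close>

type_synonym 'd phase = "real ^ ('d + 'd)"
type_synonym 'd phase_mat = "real ^ ('d + 'd) ^ ('d + 'd)"
type_synonym 'd ext_phase = "(real ^ 'd) \<times> (real ^ 'd) \<times> (real ^ 'd) \<times> (real ^ 'd)"

definition qp :: "real ^ 'd \<Rightarrow> real ^ 'd \<Rightarrow> 'd::finite phase" where
  "qp q p = (\<chi> i. case i of Inl a \<Rightarrow> q $ a | Inr a \<Rightarrow> p $ a)"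

definition pos :: "'d::finite phase \<Rightarrow> real ^ 'd" where
  "pos z = (\<chi> a. z $ Inl a)"

definition mom :: "'d::finite phase \<Rightarrow> real ^ 'd" where
  "mom z = (\<chi> a. z $ Inr a)"

lemma qp_pos_mom [simp]: "qp (pos z) (mom z) = z"
  by (simp add: qp_def pos_def mom_def vec_eq_iff split: sum.split)

lemma pos_qp [simp]: "pos (qp q p) = q" and mom_qp [simp]: "mom (qp q p) = p"
  by (simp_all add: qp_def pos_def mom_def)


definition block ::
  "real ^ 'd ^ 'd \<Rightarrow> real ^ 'd ^ 'd \<Rightarrow> real ^ 'd ^ 'd \<Rightarrow> real ^ 'd ^ 'd \<Rightarrow> 'd::finite phase_mat" where
  "block A B C D = (\<chi> i j. case i of
      Inl a \<Rightarrow> (case j of Inl b \<Rightarrow> A $ a $ b | Inr b \<Rightarrow> B $ a $ b)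
    | Inr a \<Rightarrow> (case j of Inl b \<Rightarrow> C $ a $ b | Inr b \<Rightarrow> D $ a $ b))"

definition block11 :: "'d::finite phase_mat \<Rightarrow> real ^ 'd ^ 'd" where
  "block11 S = (\<chi> a b. S $ Inl a $ Inl b)"

definition block12 :: "'d::finite phase_mat \<Rightarrow> real ^ 'd ^ 'd" where
  "block12 S = (\<chi> a b. S $ Inl a $ Inr b)"

definition block21 :: "'d::finite phase_mat \<Rightarrow> real ^ 'd ^ 'd" where
  "block21 S = (\<chi> a b. S $ Inr a $ Inl b)"

definition block22 :: "'d::finite phase_mat \<Rightarrow> real ^ 'd ^ 'd" where
  "block22 S = (\<chi> a b. S $ Inr a $ Inr b)"

lemma block_blocks [simp]: "block (block11 S) (block12 S) (block21 S) (block22 S) = S"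
  by (simp add: block_def block11_def block12_def block21_def block22_def vec_eq_iff
      split: sum.split)

definition symplJ :: "'d::finite phase_mat" where
  "symplJ = block 0 (mat 1) (- mat 1) 0"

definition Sp :: "'d::finite phase_mat set" where
  "Sp = {S. transpose S ** symplJ ** S = symplJ}"

definition sp_alg :: "'d::finite phase_mat set" where
  "sp_alg = {X. transpose X ** symplJ + symplJ ** X = 0}"

definition sym_mat :: "'d::finite phase_mat set" where
  "sym_mat = {K. transpose K = K}"


text \<open>\<open>C\<^sup>k\<close> and \<open>C\<^sup>\<infinity>\<close> maps on the whole space, via iterated directional derivatives.\<close>

fun Ck :: "nat \<Rightarrow> ('a::euclidean_space \<Rightarrow> 'b::real_normed_vector) \<Rightarrow> bool" where
  "Ck 0 f \<longleftrightarrow> continuous_on UNIV f"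
| "Ck (Suc k) f \<longleftrightarrow>
     (\<forall>x. f differentiable (at x)) \<and> (\<forall>v. Ck k (\<lambda>x. frechet_derivative f (at x) v))"

definition smooth :: "('a::euclidean_space \<Rightarrow> 'b::real_normed_vector) \<Rightarrow> bool" where
  "smooth f \<longleftrightarrow> (\<forall>k. Ck k f)"

definition grad :: "('a::real_inner \<Rightarrow> real) \<Rightarrow> 'a \<Rightarrow> 'a" where
  "grad f x = (THE D. GDERIV f x :> D)"

definition D1 :: "('d::finite phase \<Rightarrow> real) \<Rightarrow> real ^ 'd \<Rightarrow> real ^ 'd \<Rightarrow> real ^ 'd" where
  "D1 H q p = grad (\<lambda>u. H (qp u p)) q"

definition D2 :: "('d::finite phase \<Rightarrow> real) \<Rightarrow> real ^ 'd \<Rightarrow> real ^ 'd \<Rightarrow> real ^ 'd" where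
  "D2 H q p = grad (\<lambda>u. H (qp q u)) p"


text \<open>
  A matrix Lie group is a subgroup of the general linear group that is closed relative to it.
  Being an embedded submanifold of the space of matrices, its tangent space at the identity, the
  underlying space of its Lie algebra, is the set of velocities at the identity of the smooth
  matrix curves running inside the group.
\<close>

definition matrix_lie_group :: "(real ^ 'n ^ 'n::finite) set \<Rightarrow> bool" where
  "matrix_lie_group G \<longleftrightarrow>
     G \<subseteq> {A. invertible A} \<and> mat 1 \<in> G \<and> (\<forall>A\<in>G. \<forall>B\<in>G. A ** B \<in> G) \<and>
     (\<forall>A\<in>G. matrix_inv A \<in> G) \<and> closedin (top_of_set {A. invertible A}) G"

definition lie_algebra :: "(real ^ 'n ^ 'n::finite) set \<Rightarrow> (real ^ 'n ^ 'n) set" where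
  "lie_algebra G = {X. \<exists>\<gamma>. smooth \<gamma> \<and> (\<forall>t::real. \<gamma> t \<in> G) \<and> \<gamma> 0 = mat 1 \<and>
     (\<gamma> has_vector_derivative X) (at 0)}"

definition lie_algebra_sym :: "'d::finite phase_mat set \<Rightarrow> 'd phase_mat set" where
  "lie_algebra_sym G = (\<lambda>X. transpose symplJ ** X) ` lie_algebra G"


text \<open>Solutions are taken on arbitrary intervals, with one-sided derivatives at end points.\<close>

definition ode_solution ::
  "('a::real_normed_vector \<Rightarrow> 'a) \<Rightarrow> real set \<Rightarrow> (real \<Rightarrow> 'a) \<Rightarrow> bool" where
  "ode_solution F T z \<longleftrightarrow>
     is_interval T \<and> (\<forall>t\<in>T. (z has_vector_derivative F (z t)) (at t within T))"

definition ode_invariant :: "('a::real_normed_vector \<Rightarrow> 'a) \<Rightarrow> ('a \<Rightarrow> 'b) \<Rightarrow> bool" where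
  "ode_invariant F f \<longleftrightarrow>
     (\<forall>T z. ode_solution F T z \<longrightarrow> (\<forall>s\<in>T. \<forall>t\<in>T. f (z s) = f (z t)))"


definition ham_field :: "('d::finite phase \<Rightarrow> real) \<Rightarrow> 'd phase \<Rightarrow> 'd phase" where
  "ham_field H z = qp (D2 H (pos z) (mom z)) (- D1 H (pos z) (mom z))"

definition ext_H :: "('d::finite phase \<Rightarrow> real) \<Rightarrow> 'd ext_phase \<Rightarrow> real" where
  "ext_H H = (\<lambda>(q, x, p, y). H (qp q y) + H (qp x p))"

text \<open>Components in the order \<open>q\<close>, \<open>x\<close>, \<open>p\<close>, \<open>y\<close>.\<close>

definition ext_field :: "('d::finite phase \<Rightarrow> real) \<Rightarrow> 'd ext_phase \<Rightarrow> 'd ext_phase" where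
  "ext_field H = (\<lambda>(q, x, p, y). (D2 H x p, D2 H q y, - D1 H q y, - D1 H x p))"

definition ext_action :: "'d::finite phase_mat \<Rightarrow> 'd ext_phase \<Rightarrow> 'd ext_phase" where
  "ext_action S = (\<lambda>(q, x, p, y).
     (block11 S *v q + block12 S *v y, block11 S *v x + block12 S *v p,
      block21 S *v x + block22 S *v p, block21 S *v q + block22 S *v y))"

definition quad :: "'d::finite phase_mat \<Rightarrow> 'd phase \<Rightarrow> real" where
  "quad K z = 1 / 2 * (z \<bullet> (K *v z))"

definition ext_quad :: "'d::finite phase_mat \<Rightarrow> 'd ext_phase \<Rightarrow> real" where
  "ext_quad K = (\<lambda>(q, x, p, y). 1 / 2 *
     (q \<bullet> (block11 K *v x) + q \<bullet> (block12 K *v p) + x \<bullet> (block12 K *v y) + y \<bullet> (block22 K *v p)))"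


lemma sum_UNIV_Plus:
  fixes f :: "'a::finite + 'b::finite \<Rightarrow> 'c::comm_monoid_add"
  shows "(\<Sum>i\<in>UNIV. f i) = (\<Sum>a\<in>UNIV. f (Inl a)) + (\<Sum>b\<in>UNIV. f (Inr b))"
  by (subst UNIV_Plus_UNIV[symmetric], subst sum.Plus) simp_all

lemma mat_vec_qp:
  "K *v qp q p = qp (block11 K *v q + block12 K *v p) (block21 K *v q + block22 K *v p)"
  by (simp add: qp_def block11_def block12_def block21_def block22_def matrix_vector_mult_def
      vec_eq_iff sum_UNIV_Plus split: sum.split)

lemma inner_qp: "qp q p \<bullet> qp q' p' = q \<bullet> q' + p \<bullet> p'"
  by (simp add: qp_def inner_vec_def sum_UNIV_Plus)

lemma block21_sym: "K \<in> sym_mat \<Longrightarrow> block21 K = transpose (block12 K)"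
  by (simp add: sym_mat_def block12_def block21_def transpose_def vec_eq_iff)

lemma quad_qp:
  assumes "K \<in> sym_mat"
  shows "quad K (qp q p) =
    1 / 2 * (q \<bullet> (block11 K *v q)) + q \<bullet> (block12 K *v p) + 1 / 2 * (p \<bullet> (block22 K *v p))"
proof -
  have "p \<bullet> (block21 K *v q) = q \<bullet> (block12 K *v p)"
    by (simp add: block21_sym[OF assms] dot_lmul_matrix inner_commute[of p])
  then show ?thesis
    by (simp add: quad_def mat_vec_qp inner_qp inner_add_right algebra_simps)
qed

lemma lie_algebra_subset_sp:
  assumes "G \<subseteq> Sp"
  shows "lie_algebra G \<subseteq> sp_alg"
proof
  fix X assume "X \<in> lie_algebra G"
  then obtain \<gamma> where g: "\<And>t::real. \<gamma> t \<in> G" "\<gamma> 0 = mat 1"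
      and d: "(\<gamma> has_vector_derivative X) (at 0)"
    by (auto simp: lie_algebra_def)
  have c: "((\<lambda>t. \<gamma> t $ i $ j) has_real_derivative X $ i $ j) (at 0)" for i j
  proof -
    have "bounded_linear (\<lambda>A::'a phase_mat. A $ i $ j)"
      by (intro bounded_linear_compose[OF bounded_linear_vec_nth bounded_linear_vec_nth])
    from bounded_linear.has_vector_derivative[OF this d] show ?thesis
      by (simp add: has_real_derivative_iff_has_vector_derivative)
  qed
  have "(transpose X ** symplJ + symplJ ** X) $ i $ j = 0" for i j
  proof -
    have e: "(\<lambda>t. \<Sum>k\<in>UNIV. (\<Sum>l\<in>UNIV. \<gamma> t $ l $ i * symplJ $ l $ k) * \<gamma> t $ k $ j)
        = (\<lambda>t. symplJ $ i $ j)" (is "?f = _")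
    proof
      fix t
      have "transpose (\<gamma> t) ** symplJ ** \<gamma> t = symplJ"
        using g assms by (auto simp: Sp_def)
      from this[THEN arg_cong[where f = "\<lambda>A. A $ i $ j"]] show "?f t = symplJ $ i $ j"
        by (simp add: matrix_matrix_mult_def transpose_def)
    qed
    have "(?f has_real_derivative
        (\<Sum>k\<in>UNIV. (\<Sum>l\<in>UNIV. X $ l $ i * symplJ $ l $ k) * \<gamma> 0 $ k $ j
           + (\<Sum>l\<in>UNIV. \<gamma> 0 $ l $ i * symplJ $ l $ k) * X $ k $ j)) (at 0)"
      by (rule derivative_eq_intros c refl sum.cong | simp add: mult.commute)+
    moreover have "(?f has_real_derivative 0) (at 0)"
      unfolding e by simp
    ultimately have "(\<Sum>k\<in>UNIV. (\<Sum>l\<in>UNIV. X $ l $ i * symplJ $ l $ k) * \<gamma> 0 $ k $ j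
           + (\<Sum>l\<in>UNIV. \<gamma> 0 $ l $ i * symplJ $ l $ k) * X $ k $ j) = 0"
      by (rule DERIV_unique)
    then show ?thesis
      by (simp add: g mat_def matrix_matrix_mult_def transpose_def sum.distrib
          if_distrib[where f = "\<lambda>x. _ * x"] if_distrib[where f = "\<lambda>x. x * _"] cong: if_cong)
  qed
  then show "X \<in> sp_alg"
    by (simp add: sp_alg_def vec_eq_iff)
qed

lemma transpose_symplJ: "transpose symplJ = - (symplJ :: 'd::finite phase_mat)"
  by (auto simp: symplJ_def block_def transpose_def mat_def vec_eq_iff split: sum.split)

lemma lie_algebra_sym_subset_sym:
  assumes "G \<subseteq> Sp"
  shows "lie_algebra_sym G \<subseteq> sym_mat"
proof
  fix K assume "K \<in> lie_algebra_sym G"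
  then obtain X where X: "X \<in> sp_alg" "K = transpose symplJ ** X"
    using lie_algebra_subset_sp[OF assms] by (auto simp: lie_algebra_sym_def)
  have "transpose K = transpose X ** symplJ"
    by (simp add: X matrix_transpose_mul)
  also have "\<dots> = - (symplJ ** X)"
    using X by (simp add: sp_alg_def eq_neg_iff_add_eq_0)
  also have "\<dots> = K"
    by (simp add: X transpose_symplJ matrix_matrix_mult_def vec_eq_iff sum_negf)
  finally show "K \<in> sym_mat"
    by (simp add: sym_mat_def)
qed

end

theory Submission
  imports Defs
begin

text \<open>
  With \<open>u = (q, y)\<close>, \<open>v = (x, p)\<close> and \<open>F = \<J>\<nabla>H\<close> the extended system reads \<open>u' = F v\<close>, \<open>v' = F u\<close>,
  and \<open>ext_quad \<kappa>\<close> is half the symmetric bilinear form \<open>u \<bullet> \<kappa> v\<close>.  Its derivative along a solution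
  is therefore half of \<open>P u + P v\<close>, where \<open>P z = \<kappa> z \<bullet> F z\<close>, so \<open>P = 0\<close> makes \<open>ext_quad \<kappa>\<close> an
  invariant.  Invariance of \<open>ext_quad \<kappa>\<close> restricts to invariance of \<open>quad \<kappa>\<close> on the diagonal
  solutions \<open>u = v\<close>.  Conversely invariance of \<open>quad \<kappa>\<close> gives \<open>P = 0\<close>, because a solution starts at
  every point (Picard-Lindeloef).  If \<open>\<kappa> = \<J>\<^sup>T X\<close> with \<open>X\<close> the velocity of a curve of symmetries of
  \<open>H\<close>, then \<open>P z\<close> is, up to sign, the derivative of \<open>H\<close> at \<open>z\<close> along \<open>X z\<close>, which vanishes.
\<close>

section \<open>Local existence of solutions\<close>

text \<open>Banach's fixed point theorem for the Picard integral operator of a truncation of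
  \<open>F\<close>. A forward interval suffices, since only the one-sided velocity at
  \<open>z0\<close> is needed later.\<close>

lemma picard_lindeloef:
  fixes F :: "'a::euclidean_space \<Rightarrow> 'a"
  assumes r: "r > 0" and lip: "L-lipschitz_on (cball z0 r) F"
  obtains h z where "h > 0" "z 0 = z0" "ode_solution F {0..h} z"
proof -
  define c where "c = closest_point (cball z0 r)"
  have c_in: "c w \<in> cball z0 r" for w
    unfolding c_def by (rule closest_point_in_set[OF closed_cball]) (use r in simp)
  have c_self: "c w = w" if "w \<in> cball z0 r" for w
    unfolding c_def using that by (rule closest_point_self)
  have c_lip: "dist (c v) (c w) \<le> dist v w" for v w
    unfolding c_def using r by (intro closest_point_lipschitz) auto
  have L0: "L \<ge> 0"
    using lip by (rule lipschitz_on_nonneg)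
  \<comment> \<open>Truncating \<open>F\<close> outside the ball makes it bounded and globally Lipschitz.\<close>
  define E where "E = F \<circ> c"
  have E_lip: "dist (E v) (E w) \<le> L * dist v w" for v w
  proof -
    have "dist (E v) (E w) \<le> L * dist (c v) (c w)"
      unfolding E_def o_def by (rule lipschitz_onD[OF lip c_in c_in])
    also have "\<dots> \<le> L * dist v w"
      using c_lip L0 by (rule mult_left_mono)
    finally show ?thesis .
  qed
  have E_cont: "continuous_on UNIV E"
    by (rule lipschitz_on_continuous_on[of L]) (use E_lip L0 in \<open>auto intro!: lipschitz_onI\<close>)
  define M where "M = norm (F z0) + L * r"
  have M0: "M \<ge> 0"
    unfolding M_def using L0 r by simp
  have E_bound: "norm (E w) \<le> M" for w
  proof -
    have "dist (F (c w)) (F z0) \<le> L * dist (c w) z0"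
      using lip c_in[of w] r by (intro lipschitz_onD) auto
    also have "\<dots> \<le> L * r"
      using c_in[of w] L0 by (intro mult_left_mono) (auto simp: dist_commute)
    finally show ?thesis
      unfolding M_def E_def o_def dist_norm
      using norm_triangle_ineq2[of "F (c w)" "F z0"] by linarith
  qed
  \<comment> \<open>The first bound keeps a curve of speed at most \<open>M\<close> inside the ball,
    the second makes the Picard operator a contraction. Adding 1 avoids a zero denominator when
    \<open>M\<close> or \<open>L\<close> vanishes.\<close>
  define h where "h = min (r / (M + 1)) (1 / (2 * (L + 1)))"
  have h0: "h > 0"
    unfolding h_def using r M0 L0 by simp
  have hM: "h * M \<le> r"
  proof -
    have "h * M \<le> r / (M + 1) * M"
      unfolding h_def using M0 by (intro mult_right_mono) auto
    also have "\<dots> \<le> r"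
      using M0 r by (simp add: field_simps)
    finally show ?thesis .
  qed
  have hL: "h * L < 1"
  proof -
    have "h * L \<le> 1 / (2 * (L + 1)) * L"
      unfolding h_def using L0 by (intro mult_right_mono) auto
    also have "\<dots> < 1"
      using L0 by (simp add: field_simps)
    finally show ?thesis .
  qed
  \<comment> \<open>Freezing time outside \<open>{0..h}\<close> turns the Picard iterates into
    bounded continuous functions on the whole line, which form a complete space.\<close>
  define clip where "clip t = max 0 (min h t)" for t
  have clip_in: "clip t \<in> {0..h}" for t
    unfolding clip_def using h0 by auto
  have Ez_cont: "continuous_on A (\<lambda>s. E (apply_bcontfun z s))" for z and A :: "real set"
    using continuous_on_compose2[OF E_cont continuous_on_apply_bcontfun[of A z]]
    by simp
  have Ez_int: "(\<lambda>s. E (apply_bcontfun z s)) integrable_on {0..t}" for z and t :: real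
    by (rule integrable_continuous_real[OF Ez_cont])
  define I where "I z t = z0 + integral {0..clip t} (\<lambda>s. E (apply_bcontfun z s))"
    for z :: "real \<Rightarrow>\<^sub>C 'a" and t
  have I_bcontfun: "I z \<in> bcontfun" for z
  proof -
    let ?J = "\<lambda>t. z0 + integral {0..t} (\<lambda>s. E (apply_bcontfun z s))"
    have J: "continuous_on {0..h} ?J"
      by (intro continuous_intros indefinite_integral_continuous_1 Ez_int)
    have "continuous_on UNIV clip"
      unfolding clip_def by (intro continuous_intros)
    then have "continuous_on UNIV (I z)"
      unfolding I_def by (rule continuous_on_compose2[OF J]) (use clip_in in auto)
    moreover have "bounded (range (I z))"
      by (rule bounded_subset[OF compact_imp_bounded[OF compact_continuous_image[OF J compact_Icc]]])
        (use clip_in in \<open>auto simp: I_def\<close>)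
    ultimately show ?thesis
      by (simp add: bcontfun_def)
  qed
  have contr: "dist (Bcontfun (I v)) (Bcontfun (I w)) \<le> h * L * dist v w" for v w
  proof (rule dist_bound)
    fix t
    have "dist (I v t) (I w t)
        = norm (integral {0..clip t} (\<lambda>s. E (apply_bcontfun v s) - E (apply_bcontfun w s)))"
      unfolding I_def dist_norm by (simp add: integral_diff Ez_int)
    also have "\<dots> \<le> L * dist v w * (clip t - 0)"
    proof (rule integral_bound)
      show "norm (E (apply_bcontfun v s) - E (apply_bcontfun w s)) \<le> L * dist v w" for s
        using E_lip[of "apply_bcontfun v s" "apply_bcontfun w s"]
          mult_left_mono[OF dist_bounded[of v s w] L0] by (simp add: dist_norm)
    qed (use clip_in in \<open>auto intro!: continuous_intros Ez_cont\<close>)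
    also have "\<dots> \<le> L * dist v w * h"
      using clip_in[of t] L0 by (intro mult_left_mono) auto
    finally show "dist (apply_bcontfun (Bcontfun (I v)) t) (apply_bcontfun (Bcontfun (I w)) t)
        \<le> h * L * dist v w"
      by (simp add: Bcontfun_inverse I_bcontfun mult_ac)
  qed
  have "\<exists>!z. Bcontfun (I z) = z"
    by (rule banach_fix_type[where c = "h * L"]) (use h0 L0 hL contr in auto)
  then obtain zb where "Bcontfun (I zb) = zb"
    by blast
  then have fix_z: "apply_bcontfun zb = I zb"
    by (metis Bcontfun_inverse I_bcontfun)
  define z where "z = apply_bcontfun zb"
  have z_eq: "z t = z0 + integral {0..t} (\<lambda>s. E (z s))" if "t \<in> {0..h}" for t
    using that unfolding z_def by (subst fix_z) (simp add: I_def clip_def)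
  \<comment> \<open>The fixed point solves the equation for \<open>E\<close>; as it stays in the
    ball, where \<open>c\<close> is the identity, it also solves the one for
    \<open>F\<close>.\<close>
  have z_in: "z t \<in> cball z0 r" if t: "t \<in> {0..h}" for t
  proof -
    have "norm (integral {0..t} (\<lambda>s. E (z s))) \<le> M * (t - 0)"
      using t E_bound by (intro integral_bound) (auto simp: z_def Ez_cont)
    also have "\<dots> \<le> M * h"
      using t M0 by (intro mult_left_mono) auto
    finally show ?thesis
      using hM z_eq[OF t] by (simp add: dist_norm mult.commute)
  qed
  have "(z has_vector_derivative F (z t)) (at t within {0..h})" if t: "t \<in> {0..h}" for t
  proof -
    have "((\<lambda>t. integral {0..t} (\<lambda>s. E (z s))) has_vector_derivative E (z t)) (at t within {0..h})"
      by (rule integral_has_vector_derivative[OF _ t]) (simp add: z_def Ez_cont)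
    then have "((\<lambda>t. z0 + integral {0..t} (\<lambda>s. E (z s))) has_vector_derivative E (z t))
        (at t within {0..h})"
      by (auto intro!: derivative_eq_intros)
    then have "(z has_vector_derivative E (z t)) (at t within {0..h})"
      by (rule has_vector_derivative_transform[OF t, rotated]) (simp add: z_eq)
    then show ?thesis
      using c_self[OF z_in[OF t]] by (simp add: E_def)
  qed
  then have "ode_solution F {0..h} z"
    by (simp add: ode_solution_def is_interval_cc)
  moreover have "z 0 = z0"
    using z_eq[of 0] h0 by simp
  ultimately show thesis
    using h0 that by blast
qed

text \<open>Directional derivatives are continuous, hence bounded on the compact ball; the mean
  value inequality on this convex set turns a bound on the operator norm into a Lipschitz
  constant.\<close>

lemma Ck1_lipschitz_on_cball:
  fixes f :: "'a::euclidean_space \<Rightarrow> 'b::real_normed_vector"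
  assumes "Ck 1 f"
  obtains L where "L-lipschitz_on (cball z r) f"
proof -
  let ?f' = "\<lambda>x. frechet_derivative f (at x)"
  have diff: "(f has_derivative ?f' x) (at x)" for x
    using assms by (simp add: frechet_derivative_works)
  have "\<exists>B. \<forall>x\<in>cball z r. norm (?f' x b) \<le> B" for b
  proof -
    have "continuous_on (cball z r) (\<lambda>x. ?f' x b)"
      using assms by (auto intro: continuous_on_subset)
    then have "bounded ((\<lambda>x. ?f' x b) ` cball z r)"
      by (intro compact_imp_bounded compact_continuous_image compact_cball)
    then show ?thesis
      by (auto simp: bounded_iff)
  qed
  then obtain B where B: "\<And>b x. x \<in> cball z r \<Longrightarrow> norm (?f' x b) \<le> B b"
    by metis
  \<comment> \<open>Each coordinate of \<open>v\<close> is at most \<open>norm v\<close> in size, so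
    the bounds along \<open>Basis\<close> add up to one for the operator norm. Absolute values keep
    \<open>L\<close> nonnegative even if the ball is empty and \<open>B\<close> arbitrary.\<close>
  define L where "L = (\<Sum>b\<in>Basis. \<bar>B b\<bar>)"
  have L0: "L \<ge> 0"
    unfolding L_def by (simp add: sum_nonneg)
  have "onorm (?f' x) \<le> L" if x: "x \<in> cball z r" for x
  proof (rule onorm_bound[OF L0])
    fix v
    have lin: "linear (?f' x)"
      using diff by (rule has_derivative_linear)
    have "?f' x v = ?f' x (\<Sum>b\<in>Basis. (v \<bullet> b) *\<^sub>R b)"
      by (simp add: euclidean_representation)
    also have "\<dots> = (\<Sum>b\<in>Basis. (v \<bullet> b) *\<^sub>R ?f' x b)"
      by (simp add: linear_sum[OF lin] linear_cmul[OF lin])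
    also have "norm \<dots> \<le> (\<Sum>b\<in>Basis. norm v * \<bar>B b\<bar>)"
    proof (rule sum_norm_le)
      fix b :: 'a assume "b \<in> Basis"
      then show "norm ((v \<bullet> b) *\<^sub>R ?f' x b) \<le> norm v * \<bar>B b\<bar>"
        using Basis_le_norm[of b v] B[OF x, of b] by (auto intro!: mult_mono)
    qed
    finally show "norm (?f' x v) \<le> L * norm v"
      by (simp add: L_def sum_distrib_left mult.commute)
  qed
  then have "norm (f x - f y) \<le> L * norm (x - y)"
    if "x \<in> cball z r" "y \<in> cball z r" for x y
    using that diff by (intro differentiable_bound[where f' = ?f' and S = "cball z r"])
      (auto intro: has_derivative_at_withinI)
  then have "L-lipschitz_on (cball z r) f"
    using L0 by (auto intro!: lipschitz_onI simp: dist_norm)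
  then show thesis
    by (rule that)
qed

section \<open>The Hamiltonian vector field\<close>

lemma grad_eqI:
  assumes "(f has_derivative (\<lambda>h. h \<bullet> D)) (at x)"
  shows "grad f x = D"
  unfolding grad_def
proof (rule the_equality)
  show "GDERIV f x :> D"
    using assms by (simp add: gderiv_def)
next
  fix D' assume "GDERIV f x :> D'"
  then have "(\<lambda>h. h \<bullet> D') = (\<lambda>h. h \<bullet> D)"
    using assms by (auto simp: gderiv_def intro: has_derivative_unique)
  then show "D' = D"
    by (metis vector_eq_ldot)
qed

text \<open>\<open>adjoint f' 1\<close> is the Riesz vector of the functional
  \<open>f'\<close>.\<close>

lemma inner_grad:
  fixes f :: "'a::euclidean_space \<Rightarrow> real"
  assumes f: "(f has_derivative f') (at x)"
  shows "h \<bullet> grad f x = f' h"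
proof -
  have lin: "linear f'"
    using f by (rule has_derivative_linear)
  have adj: "f' h = h \<bullet> adjoint f' 1" for h
    using adjoint_works[OF lin, of h 1] by simp
  then have "f' = (\<lambda>h. h \<bullet> adjoint f' 1)"
    by blast
  with f have "grad f x = adjoint f' 1"
    by (intro grad_eqI) simp
  then show ?thesis
    by (simp add: adj)
qed

lemma qp_add: "qp (a + b) (c + d) = qp a c + qp b d"
  by (simp add: qp_def vec_eq_iff split: sum.split)

lemma bounded_linear_qp_0: "bounded_linear (\<lambda>q. qp q 0)"
  by (intro linear_conv_bounded_linear[THEN iffD1] linearI) (auto simp: qp_def vec_eq_iff split: sum.split)

lemma bounded_linear_0_qp: "bounded_linear (\<lambda>p. qp 0 p)"
  by (intro linear_conv_bounded_linear[THEN iffD1] linearI) (auto simp: qp_def vec_eq_iff split: sum.split)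

lemma has_vector_derivative_qp:
  assumes "(q has_vector_derivative q') F" "(p has_vector_derivative p') F"
  shows "((\<lambda>t. qp (q t) (p t)) has_vector_derivative qp q' p') F"
  using has_vector_derivative_add[OF
      bounded_linear.has_vector_derivative[OF bounded_linear_qp_0 assms(1)]
      bounded_linear.has_vector_derivative[OF bounded_linear_0_qp assms(2)]]
  by (simp flip: qp_add)

text \<open>The chain rule along the two affine slices through \<open>qp q p\<close>, combined by
  linearity of \<open>H'\<close>.\<close>

lemma inner_D1_D2:
  assumes H: "(H has_derivative H') (at (qp q p))"
  shows "a \<bullet> D1 H q p + b \<bullet> D2 H q p = H' (qp a b)"
proof -
  have "((\<lambda>u. qp u p) has_derivative (\<lambda>u. qp u 0)) (at q)"
    using has_derivative_add_const[OF bounded_linear_imp_has_derivative[OF bounded_linear_qp_0], where c = "qp 0 p"]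
    by (simp flip: qp_add)
  from has_derivative_compose[OF this H] have 1: "a \<bullet> D1 H q p = H' (qp a 0)"
    unfolding D1_def by (rule inner_grad)
  have "((\<lambda>u. qp q u) has_derivative (\<lambda>u. qp 0 u)) (at p)"
    using has_derivative_add_const[OF bounded_linear_imp_has_derivative[OF bounded_linear_0_qp], where c = "qp q 0"]
    by (simp flip: qp_add)
  from has_derivative_compose[OF this H] have 2: "b \<bullet> D2 H q p = H' (qp 0 b)"
    unfolding D2_def by (rule inner_grad)
  show ?thesis
    unfolding 1 2 by (simp flip: linear_add[OF has_derivative_linear[OF H]] qp_add)
qed

text \<open>The vector \<open>qp (- mom w) (pos w)\<close> is J^T w, so this moves J in J grad H to
  the other side of the inner product.\<close>

lemma inner_ham_field:
  assumes "(H has_derivative H') (at z)"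
  shows "w \<bullet> ham_field H z = H' (qp (- mom w) (pos w))"
proof -
  have "w \<bullet> ham_field H z = qp (pos w) (mom w) \<bullet> ham_field H z"
    by simp
  also have "\<dots> = - mom w \<bullet> D1 H (pos z) (mom z) + pos w \<bullet> D2 H (pos z) (mom z)"
    by (simp add: ham_field_def inner_qp del: qp_pos_mom)
  also have "\<dots> = H' (qp (- mom w) (pos w))"
    using assms by (intro inner_D1_D2) simp
  finally show ?thesis .
qed

lemma smooth_has_derivative:
  assumes "smooth f"
  shows "(f has_derivative frechet_derivative f (at x)) (at x)"
  using assms[unfolded smooth_def, rule_format, of 1] by (simp add: frechet_derivative_works)

text \<open>Each component of the field is a derivative of \<open>H\<close> in a fixed direction,
  hence \<open>Ck 1\<close> because \<open>H\<close> is \<open>Ck 2\<close>. The constants of the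
  components are summed via the l1 norm.\<close>

lemma ham_field_lipschitz_on_cball:
  assumes "smooth H"
  obtains L where "L-lipschitz_on (cball z r) (ham_field H)"
proof -
  have "\<exists>L. L-lipschitz_on (cball z r) (\<lambda>z. ham_field H z \<bullet> b)" for b
  proof -
    have eq: "(\<lambda>z. ham_field H z \<bullet> b)
        = (\<lambda>z. frechet_derivative H (at z) (qp (- mom b) (pos b)))"
      using inner_ham_field[OF smooth_has_derivative[OF assms]] by (simp add: inner_commute)
    have "Ck 2 H"
      using assms by (simp add: smooth_def)
    then have "Ck 1 (\<lambda>z. ham_field H z \<bullet> b)"
      unfolding eq by (simp add: numeral_2_eq_2)
    then show ?thesis
      by (rule Ck1_lipschitz_on_cball) blast
  qed
  then obtain L where L: "\<And>b. (L b)-lipschitz_on (cball z r) (\<lambda>z. ham_field H z \<bullet> b)"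
    by metis
  have "(\<Sum>b\<in>Basis. L b)-lipschitz_on (cball z r) (ham_field H)"
  proof (rule lipschitz_onI)
    fix u v assume uv: "u \<in> cball z r" "v \<in> cball z r"
    have "dist (ham_field H u) (ham_field H v)
        \<le> (\<Sum>b\<in>Basis. \<bar>(ham_field H u - ham_field H v) \<bullet> b\<bar>)"
      unfolding dist_norm by (rule norm_le_l1)
    also have "\<dots> \<le> (\<Sum>b\<in>Basis. L b * dist u v)"
      using lipschitz_onD[OF L uv] by (intro sum_mono) (simp add: dist_real_def inner_diff_left)
    finally show "dist (ham_field H u) (ham_field H v) \<le> (\<Sum>b\<in>Basis. L b) * dist u v"
      by (simp add: sum_distrib_right)
  qed (use lipschitz_on_nonneg[OF L] in \<open>simp add: sum_nonneg\<close>)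
  then show thesis
    by (rule that)
qed

section \<open>Quadratic invariants\<close>

lemma inner_sym_mat:
  assumes "K \<in> sym_mat"
  shows "u \<bullet> (K *v v) = (K *v u) \<bullet> v"
  using assms by (simp add: sym_mat_def flip: dot_lmul_matrix transpose_matrix_vector)

text \<open>Symmetry turns the term of \<open>ext_quad\<close> in \<open>x\<close> and
  \<open>y\<close> into the missing one with \<open>block21 K\<close>. In this polar form the
  product rule applies.\<close>

lemma ext_quad_eq:
  assumes "K \<in> sym_mat"
  shows "ext_quad K (q, x, p, y) = 1 / 2 * (qp q y \<bullet> (K *v qp x p))"
proof -
  have "y \<bullet> (block21 K *v x) = x \<bullet> (block12 K *v y)"
    by (simp add: block21_sym[OF assms] dot_lmul_matrix inner_commute[of y])
  then show ?thesis
    by (simp add: ext_quad_def mat_vec_qp inner_qp inner_add_right)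
qed

lemma has_vector_derivative_bilinear_form:
  fixes K :: "real ^ 'n ^ 'n"
  assumes "(u has_vector_derivative u') (at t within T)" "(v has_vector_derivative v') (at t within T)"
  shows "((\<lambda>t. u t \<bullet> (K *v v t)) has_vector_derivative u t \<bullet> (K *v v') + u' \<bullet> (K *v v t))
    (at t within T)"
  by (rule bounded_bilinear.has_vector_derivative[OF bounded_bilinear_inner assms(1)
        bounded_linear.has_vector_derivative[OF matrix_vector_mul_bounded_linear assms(2)]])

lemma ode_invariant_ext_quad:
  fixes H :: "'d::finite phase \<Rightarrow> real"
  assumes K: "K \<in> sym_mat" and P: "\<And>z. (K *v z) \<bullet> ham_field H z = 0"
  shows "ode_invariant (ext_field H) (ext_quad K)"
  unfolding ode_invariant_def
proof (intro allI impI ballI)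
  fix T \<zeta> s t
  assume sol: "ode_solution (ext_field H) T \<zeta>" and st: "s \<in> T" "t \<in> T"
  define q x p y where "q = (\<lambda>t. fst (\<zeta> t))" "x = (\<lambda>t. fst (snd (\<zeta> t)))"
    "p = (\<lambda>t. fst (snd (snd (\<zeta> t))))" "y = (\<lambda>t. snd (snd (snd (\<zeta> t))))"
  have \<zeta>: "\<zeta> t = (q t, x t, p t, y t)" for t
    by (simp add: q_x_p_y_def)
  let ?u = "\<lambda>t. qp (q t) (y t)" and ?v = "\<lambda>t. qp (x t) (p t)"
  have "((\<lambda>t. ?u t \<bullet> (K *v ?v t)) has_vector_derivative 0) (at t within T)" if t: "t \<in> T" for t
  proof -
    have d: "(\<zeta> has_vector_derivative
        (D2 H (x t) (p t), D2 H (q t) (y t), - D1 H (q t) (y t), - D1 H (x t) (p t)))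
        (at t within T)"
      using sol t by (simp add: ode_solution_def ext_field_def \<zeta>)
    note fs = bounded_linear.has_vector_derivative[OF bounded_linear_fst]
      and sn = bounded_linear.has_vector_derivative[OF bounded_linear_snd]
    have "(?u has_vector_derivative ham_field H (?v t)) (at t within T)"
      using has_vector_derivative_qp[OF fs[OF d] sn[OF sn[OF sn[OF d]]]]
      by (simp add: q_x_p_y_def ham_field_def)
    moreover have "(?v has_vector_derivative ham_field H (?u t)) (at t within T)"
      using has_vector_derivative_qp[OF fs[OF sn[OF d]] fs[OF sn[OF sn[OF d]]]]
      by (simp add: q_x_p_y_def ham_field_def)
    ultimately have "((\<lambda>t. ?u t \<bullet> (K *v ?v t)) has_vector_derivative
        ?u t \<bullet> (K *v ham_field H (?u t)) + ham_field H (?v t) \<bullet> (K *v ?v t)) (at t within T)"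
      by (rule has_vector_derivative_bilinear_form)
    \<comment> \<open>Symmetry of \<open>K\<close> makes both terms instances of \<open>P\<close>,
      one at \<open>?u t\<close> and one at \<open>?v t\<close>.\<close>
    then show ?thesis
      by (simp add: inner_sym_mat[OF K, of "?u t"] inner_commute[of "ham_field H (?v t)"] P)
  qed
  then have "\<exists>c. \<forall>t\<in>T. ?u t \<bullet> (K *v ?v t) = c"
    using sol by (intro has_derivative_zero_constant)
      (auto simp: has_vector_derivative_def ode_solution_def is_interval_convex)
  then show "ext_quad K (\<zeta> s) = ext_quad K (\<zeta> t)"
    using st by (auto simp: \<zeta> ext_quad_eq[OF K])
qed

text \<open>On the diagonal \<open>x = q\<close>, \<open>y = p\<close> the extended field is two
  copies of \<open>ham_field H\<close>, so doubling a solution gives an extended solution, along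
  which \<open>ext_quad K\<close> equals \<open>quad K\<close>.\<close>

lemma ode_invariant_quad_if_ext_quad:
  assumes K: "K \<in> sym_mat" and inv: "ode_invariant (ext_field H) (ext_quad K)"
  shows "ode_invariant (ham_field H) (quad K)"
  unfolding ode_invariant_def
proof (intro allI impI ballI)
  fix T z s t
  assume sol: "ode_solution (ham_field H) T z" and st: "s \<in> T" "t \<in> T"
  let ?\<zeta> = "\<lambda>t. (pos (z t), pos (z t), mom (z t), mom (z t))"
  have bl: "bounded_linear pos" "bounded_linear mom"
    by (auto intro!: linear_conv_bounded_linear[THEN iffD1] linearI simp: pos_def mom_def vec_eq_iff)
  have "(?\<zeta> has_vector_derivative ext_field H (?\<zeta> t)) (at t within T)" if t: "t \<in> T" for t
  proof -
    have d: "(z has_vector_derivative ham_field H (z t)) (at t within T)"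
      using sol t by (simp add: ode_solution_def)
    have "((\<lambda>t. pos (z t)) has_vector_derivative D2 H (pos (z t)) (mom (z t))) (at t within T)"
      using bounded_linear.has_vector_derivative[OF bl(1) d] by (simp add: ham_field_def)
    moreover have "((\<lambda>t. mom (z t)) has_vector_derivative - D1 H (pos (z t)) (mom (z t)))
        (at t within T)"
      using bounded_linear.has_vector_derivative[OF bl(2) d] by (simp add: ham_field_def)
    ultimately show ?thesis
      by (simp add: ext_field_def has_vector_derivative_Pair)
  qed
  then have "ode_solution (ext_field H) T ?\<zeta>"
    using sol by (simp add: ode_solution_def)
  then have "ext_quad K (?\<zeta> s) = ext_quad K (?\<zeta> t)"
    using inv st by (auto simp: ode_invariant_def)
  then show "quad K (z s) = quad K (z t)"
    by (simp add: ext_quad_eq[OF K] quad_def)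
qed

text \<open>The inner product is the initial rate of change of \<open>quad K\<close> along a
  solution starting at \<open>z\<close>.\<close>

lemma inner_ham_field_eq_0_if_ode_invariant_quad:
  assumes H: "smooth H" and K: "K \<in> sym_mat" and inv: "ode_invariant (ham_field H) (quad K)"
  shows "(K *v z) \<bullet> ham_field H z = 0"
proof -
  obtain L where "L-lipschitz_on (cball z 1) (ham_field H)"
    using ham_field_lipschitz_on_cball[OF H] .
  then obtain h w where h: "h > 0" and w0: "w 0 = z" and sol: "ode_solution (ham_field H) {0..h} w"
    using picard_lindeloef[of 1] by (metis zero_less_one)
  have z0: "0 \<in> {0..h}"
    using h by simp
  have d: "(w has_vector_derivative ham_field H z) (at 0 within {0..h})"
    using sol z0 unfolding ode_solution_def w0[symmetric] by blast
  from has_vector_derivative_bilinear_form[OF d d, of K]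
  have 1: "((\<lambda>t. w t \<bullet> (K *v w t)) has_vector_derivative 2 * ((K *v z) \<bullet> ham_field H z))
      (at 0 within {0..h})"
    by (simp add: w0 inner_sym_mat[OF K, of z] inner_commute[of "ham_field H z"])
  have const: "w t \<bullet> (K *v w t) = z \<bullet> (K *v z)" if "t \<in> {0..h}" for t
  proof -
    have "quad K (w t) = quad K (w 0)"
      using inv sol that z0 unfolding ode_invariant_def by blast
    then show ?thesis
      by (simp add: quad_def w0)
  qed
  have 2: "((\<lambda>t. w t \<bullet> (K *v w t)) has_vector_derivative 0) (at 0 within {0..h})"
    by (rule has_vector_derivative_transform[OF z0 const has_vector_derivative_const])
  \<comment> \<open>One-sided derivatives at the end point 0 are unique because the interval has
    positive length.\<close>
  have "2 * ((K *v z) \<bullet> ham_field H z) = 0"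
    by (rule vector_derivative_unique_within_closed_interval[OF h _ 1 [folded cbox_interval]
          2 [folded cbox_interval]]) (use h in simp)
  then show ?thesis
    by simp
qed

text \<open>Noether's argument. \<open>inner_ham_field\<close> applies J^T to \<open>K *v z\<close>,
  which is itself J^T X z; since J^T J^T = -I, what remains is the derivative of \<open>H\<close>
  along - X z, and \<open>H\<close> is constant on the orbit of \<open>z\<close>.\<close>

lemma inner_ham_field_eq_0_if_symmetry:
  assumes H: "smooth H" and sym: "\<And>S z. S \<in> G \<Longrightarrow> H (S *v z) = H z"
    and K: "K \<in> lie_algebra_sym G"
  shows "(K *v z) \<bullet> ham_field H z = 0"
proof -
  obtain X \<gamma> where X: "K = transpose symplJ ** X"
      and \<gamma>: "\<And>t::real. \<gamma> t \<in> G" "\<gamma> 0 = mat 1" "(\<gamma> has_vector_derivative X) (at 0)"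
    using K by (auto simp: lie_algebra_sym_def lie_algebra_def)
  let ?H' = "frechet_derivative H (at z)"
  have H': "(H has_derivative ?H') (at z)"
    using H by (rule smooth_has_derivative)
  have "bounded_linear (\<lambda>A::'a phase_mat. A *v z)"
    by (intro linear_conv_bounded_linear[THEN iffD1] linearI)
      (auto simp: matrix_vector_mult_add_rdistrib scaleR_matrix_vector_assoc)
  then have "((\<lambda>t. \<gamma> t *v z) has_vector_derivative X *v z) (at 0)"
    using \<gamma>(3) by (rule bounded_linear.has_vector_derivative)
  then have "((\<lambda>t. H (\<gamma> t *v z)) has_derivative (\<lambda>t. ?H' (t *\<^sub>R (X *v z)))) (at 0)"
    unfolding has_vector_derivative_def
    by (rule has_derivative_compose) (simp add: \<gamma> H')
  moreover have "((\<lambda>t. H (\<gamma> t *v z)) has_derivative (\<lambda>t. 0)) (at 0)"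
    by (simp add: sym \<gamma>)
  ultimately have "(\<lambda>t. ?H' (t *\<^sub>R (X *v z))) = (\<lambda>t. 0)"
    by (rule has_derivative_unique)
  from fun_cong[OF this, of 1] have 0: "?H' (X *v z) = 0"
    by simp
  have J: "transpose symplJ *v w = qp (- mom w) (pos w)" for w :: "'a phase"
  proof -
    have "transpose symplJ *v qp (pos w) (mom w) = qp (- mom w) (pos w)"
      unfolding transpose_symplJ mat_vec_qp
      by (simp add: symplJ_def block_def block11_def block12_def block21_def block22_def qp_def
          matrix_vector_mult_def mat_def vec_eq_iff sum_negf if_distrib[where f = "\<lambda>x. x * _"]
          if_distrib[where f = uminus] cong: if_cong split: sum.split)
    then show ?thesis
      by simp
  qed
  have "K *v z = qp (- mom (X *v z)) (pos (X *v z))"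
    unfolding X matrix_vector_mul_assoc[symmetric] J ..
  then have "(K *v z) \<bullet> ham_field H z = ?H' (qp (- pos (X *v z)) (- mom (X *v z)))"
    by (simp add: inner_ham_field[OF H'])
  also have "qp (- pos (X *v z)) (- mom (X *v z)) = - (X *v z)"
    by (simp add: qp_def pos_def mom_def vec_eq_iff split: sum.split)
  finally show ?thesis
    by (simp add: linear_neg[OF has_derivative_linear[OF H']] 0)
qed

text \<open>\<open>ext_action S\<close> acts as \<open>S\<close> on each of the pairs
  \<open>(q, y)\<close> and \<open>(x, p)\<close>.\<close>

lemma ext_H_ext_action:
  assumes "\<And>z. H (S *v z) = H z"
  shows "ext_H H (ext_action S \<zeta>) = ext_H H \<zeta>"
  using assms[of "qp (fst \<zeta>) (snd (snd (snd \<zeta>)))"] assms[of "qp (fst (snd \<zeta>)) (fst (snd (snd \<zeta>)))"]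
  by (simp add: ext_H_def ext_action_def mat_vec_qp case_prod_unfold)

theorem proposition8:
  fixes H :: "'d::finite phase \<Rightarrow> real" and G :: "'d phase_mat set"
  assumes "smooth H"
    and "matrix_lie_group G" and "G \<subseteq> Sp"
  shows "((\<forall>S\<in>G. \<forall>z. H (S *v z) = H z) \<longrightarrow>
            (\<forall>S\<in>G. \<forall>\<zeta>. ext_H H (ext_action S \<zeta>) = ext_H H \<zeta>) \<and>
            (\<forall>\<kappa>\<in>lie_algebra_sym G.
               ode_invariant (ham_field H) (quad \<kappa>) \<and>
               ode_invariant (ext_field H) (ext_quad \<kappa>))) \<and>
         (\<forall>\<kappa>\<in>sym_mat.
            ode_invariant (ham_field H) (quad \<kappa>) \<longleftrightarrow>
            ode_invariant (ext_field H) (ext_quad \<kappa>))"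
proof (intro conjI impI ballI allI)
  fix S \<zeta> assume "\<forall>S\<in>G. \<forall>z. H (S *v z) = H z" "S \<in> G"
  then show "ext_H H (ext_action S \<zeta>) = ext_H H \<zeta>"
    by (simp add: ext_H_ext_action)
next
  fix \<kappa> assume sym: "\<forall>S\<in>G. \<forall>z. H (S *v z) = H z" and \<kappa>: "\<kappa> \<in> lie_algebra_sym G"
  have \<kappa>_sym: "\<kappa> \<in> sym_mat"
    using \<kappa> lie_algebra_sym_subset_sym[OF assms(3)] by blast
  show ext: "ode_invariant (ext_field H) (ext_quad \<kappa>)"
    using sym by (intro ode_invariant_ext_quad[OF \<kappa>_sym]
        inner_ham_field_eq_0_if_symmetry[OF assms(1) _ \<kappa>]) auto
  show "ode_invariant (ham_field H) (quad \<kappa>)"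
    using \<kappa>_sym ext by (rule ode_invariant_quad_if_ext_quad)
next
  fix \<kappa> :: "'d phase_mat" assume \<kappa>: "\<kappa> \<in> sym_mat"
  \<comment> \<open>Forward, the link is the pointwise identity \<open>P = 0\<close>; backward,
    restriction to the diagonal.\<close>
  show "ode_invariant (ham_field H) (quad \<kappa>) \<longleftrightarrow> ode_invariant (ext_field H) (ext_quad \<kappa>)"
    using ode_invariant_ext_quad[OF \<kappa>] inner_ham_field_eq_0_if_ode_invariant_quad[OF assms(1) \<kappa>]
      ode_invariant_quad_if_ext_quad[OF \<kappa>] by blast
qed

end
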